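(* Let $n\geqslant 1$, let $\tilde c_1,\dots,\tilde c_n\in\mathbb{R}^d$ and $A_1,\dots,A_n\in S_{++}^d$, and let $\lambda^*\in\operatorname{argmin}_{\lambda\in\Delta^n}F(\lambda)$. Then: (1) For every $r\geqslant 0$, $$\bigcap_{i=1}^nE_r(\tilde c_i,A_i)\neq\emptyset\iff g(\lambda^*;r)\leqslant 0 .$$ (2) The smallest radius $r^*\geqslant 0$ that yields a non-empty intersection is $$r^*=\sqrt{\max_{1\leqslant i\leqslant n}\|\tilde c_i-m(\lambda^* )\|_{A_i}^2}=\sqrt{-F(\lambda^* )}=\sqrt{h(\lambda^* )}\,,$$ and at this radius $g(\lambda^*;r^* )=0$ and $E_{\lambda^*,r^*}=\{m(\lambda^* )\}$. (3) These formulas remain valid in the degenerate case $r^*=0$, which occurs if and only if $\tilde c_1=\dots=\tilde c_n$; in particular, for $n=1$ one has $m(\lambda^* )=\tilde c_1$ and $r^*=0$.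
   Context: $S_{++}^d$ is the set of real symmetric positive definite $d\times d$ matrices. For $A\in S_{++}^d$, $\|z\|_A=\sqrt{z^\top A z}$. For $r\geqslant 0$, $E_r(\tilde c,A)=\{x\in\mathbb{R}^d : (x-\tilde c)^\top A(x-\tilde c)\leqslant r^2\}$ (so $E_0(\tilde c,A)=\{\tilde c\}$). The probability simplex is $\Delta^n=\{\lambda\in\mathbb{R}^n:\lambda_i\geqslant 0 \text{ for all } i,\ \sum_{i=1}^n\lambda_i=1\}$. Given $\tilde c_1,\dots,\tilde c_n$ and $A_1,\dots,A_n$, put $b_i=-A_i\tilde c_i$, $\gamma_i(r)=\tilde c_i^\top A_i\tilde c_i-r^2$, and $f_i(x;r)=x^\top A_ix+2b_i^\top x+\gamma_i(r)$. For $\lambda\in\mathbb{R}^n$ with all $\lambda_i\geqslant 0$ and $\lambda\neq 0$, put $A(\lambda)=\sum_i\lambda_iA_i$ (which is positive definite), $b(\lambda)=\sum_i\lambda_ib_i$, $\gamma(\lambda;r)=\sum_i\lambda_i\gamma_i(r)$, $m(\lambda)=-A(\lambda)^{-1}b(\lambda)$, $$g(\lambda;r)=\gamma(\lambda;r)-b(\lambda)^\top A(\lambda)^{-1}b(\lambda),$$ $$h(\lambda)=\sum_{i=1}^n\lambda_i\tilde c_i^\top A_i\tilde c_i-b(\lambda)^\top A(\lambda)^{-1}b(\lambda),\qquad F(\lambda)=-h(\lambda),$$ and $E_{\lambda,r}=\{x\in\mathbb{R}^d:\sum_{i=1}^n\lambda_if_i(x;r)\leqslant 0\}$. *)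

theory Defs
  imports "HOL-Analysis.Analysis"
begin

text \<open>The number of ellipsoids and the dimension of the space are \<^term>\<open>CARD('n)\<close> and
  \<^term>\<open>CARD('d)\<close> for finite index types, hence both are at least 1.\<close>

definition spd_matrices :: "(real^'d^'d) set" where
  "spd_matrices = {A. transpose A = A \<and> (\<forall>x. x \<noteq> 0 \<longrightarrow> 0 < x \<bullet> (A *v x))}"

definition norm_wrt :: "real^'d^'d \<Rightarrow> real^'d \<Rightarrow> real" where
  "norm_wrt A z = sqrt (z \<bullet> (A *v z))"

definition ellipsoid :: "real \<Rightarrow> real^'d \<Rightarrow> real^'d^'d \<Rightarrow> (real^'d) set" where
  "ellipsoid r c A = {x. (x - c) \<bullet> (A *v (x - c)) \<le> r\<^sup>2}"

definition prob_simplex :: "(real^'n) set" where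
  "prob_simplex = {l. (\<forall>i. 0 \<le> l $ i) \<and> (\<Sum>i\<in>UNIV. l $ i) = 1}"

definition b_vec :: "('n \<Rightarrow> real^'d) \<Rightarrow> ('n \<Rightarrow> real^'d^'d) \<Rightarrow> 'n \<Rightarrow> real^'d" where
  "b_vec c A i = - (A i *v c i)"

definition gamma_const ::
  "('n \<Rightarrow> real^'d) \<Rightarrow> ('n \<Rightarrow> real^'d^'d) \<Rightarrow> 'n \<Rightarrow> real \<Rightarrow> real" where
  "gamma_const c A i r = c i \<bullet> (A i *v c i) - r\<^sup>2"

definition f_quad ::
  "('n \<Rightarrow> real^'d) \<Rightarrow> ('n \<Rightarrow> real^'d^'d) \<Rightarrow> 'n \<Rightarrow> real^'d \<Rightarrow> real \<Rightarrow> real" where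
  "f_quad c A i x r = x \<bullet> (A i *v x) + 2 * (b_vec c A i \<bullet> x) + gamma_const c A i r"

definition A_comb :: "('n \<Rightarrow> real^'d^'d) \<Rightarrow> real^'n \<Rightarrow> real^'d^'d" where
  "A_comb A l = (\<Sum>i\<in>UNIV. (l $ i) *\<^sub>R A i)"

definition b_comb :: "('n \<Rightarrow> real^'d) \<Rightarrow> ('n \<Rightarrow> real^'d^'d) \<Rightarrow> real^'n \<Rightarrow> real^'d" where
  "b_comb c A l = (\<Sum>i\<in>UNIV. (l $ i) *\<^sub>R b_vec c A i)"

definition gamma_comb ::
  "('n \<Rightarrow> real^'d) \<Rightarrow> ('n \<Rightarrow> real^'d^'d) \<Rightarrow> real^'n \<Rightarrow> real \<Rightarrow> real" where
  "gamma_comb c A l r = (\<Sum>i\<in>UNIV. l $ i * gamma_const c A i r)"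

definition m_center :: "('n \<Rightarrow> real^'d) \<Rightarrow> ('n \<Rightarrow> real^'d^'d) \<Rightarrow> real^'n \<Rightarrow> real^'d" where
  "m_center c A l = - (matrix_inv (A_comb A l) *v b_comb c A l)"

definition g_fun ::
  "('n \<Rightarrow> real^'d) \<Rightarrow> ('n \<Rightarrow> real^'d^'d) \<Rightarrow> real^'n \<Rightarrow> real \<Rightarrow> real" where
  "g_fun c A l r =
     gamma_comb c A l r - b_comb c A l \<bullet> (matrix_inv (A_comb A l) *v b_comb c A l)"

definition h_fun :: "('n \<Rightarrow> real^'d) \<Rightarrow> ('n \<Rightarrow> real^'d^'d) \<Rightarrow> real^'n \<Rightarrow> real" where
  "h_fun c A l =
     (\<Sum>i\<in>UNIV. l $ i * (c i \<bullet> (A i *v c i)))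
       - b_comb c A l \<bullet> (matrix_inv (A_comb A l) *v b_comb c A l)"

definition F_fun :: "('n \<Rightarrow> real^'d) \<Rightarrow> ('n \<Rightarrow> real^'d^'d) \<Rightarrow> real^'n \<Rightarrow> real" where
  "F_fun c A l = - h_fun c A l"

definition E_comb ::
  "('n \<Rightarrow> real^'d) \<Rightarrow> ('n \<Rightarrow> real^'d^'d) \<Rightarrow> real^'n \<Rightarrow> real \<Rightarrow> (real^'d) set" where
  "E_comb c A l r = {x. (\<Sum>i\<in>UNIV. l $ i * f_quad c A i x r) \<le> 0}"

definition feasible_radii :: "('n \<Rightarrow> real^'d) \<Rightarrow> ('n \<Rightarrow> real^'d^'d) \<Rightarrow> real set" where
  "feasible_radii c A = {r. 0 \<le> r \<and> (\<Inter>i. ellipsoid r (c i) (A i)) \<noteq> {}}"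

text \<open>\<open>LEAST\<close> on the reals is meaningful only if the minimum is attained; statements about
  \<open>r_star\<close> should therefore assert attainment as well.\<close>

definition r_star :: "('n \<Rightarrow> real^'d) \<Rightarrow> ('n \<Rightarrow> real^'d^'d) \<Rightarrow> real" where
  "r_star c A = (LEAST r. r \<in> feasible_radii c A)"

end

theory Submission
  imports Defs
begin

text \<open>With \<open>q\<^sub>i x\<close> the squared \<open>A\<^sub>i\<close>-distance from \<open>c\<^sub>i\<close>, completing the square gives
  \<open>\<Sum>\<lambda>\<^sub>i q\<^sub>i x = h \<lambda> + (x - m) \<bullet> A(\<lambda>) (x - m)\<close> where \<open>m = m(\<lambda>)\<close>. Moving a maximiser \<open>\<lambda>\<^sup>*\<close>
  of \<open>h\<close> a step \<open>t\<close> towards the \<open>i\<close>-th vertex of the simplex cannot increase \<open>h\<close>; this bounds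
  \<open>q\<^sub>i\<close> by \<open>h \<lambda>\<^sup>*\<close> at the new centre and forces the new centre to converge to \<open>m(\<lambda>\<^sup>*)\<close> as
  \<open>t\<close> tends to 0. Hence \<open>q\<^sub>i (m(\<lambda>\<^sup>*)) \<le> h \<lambda>\<^sup>*\<close> for all \<open>i\<close>, while \<open>h \<lambda>\<^sup>*\<close> is a lower bound for
  \<open>max\<^sub>i q\<^sub>i\<close> on the whole space.\<close>

section \<open>Positive definite matrices\<close>

lemma spd_inner_sym:
  assumes "A \<in> spd_matrices"
  shows "x \<bullet> (A *v y) = y \<bullet> (A *v x)"
  using assms by (metis (mono_tags, lifting) dot_lmul_matrix inner_commute mem_Collect_eq
      spd_matrices_def transpose_matrix_vector)

lemma spd_pos: "A \<in> spd_matrices \<Longrightarrow> x \<noteq> 0 \<Longrightarrow> 0 < x \<bullet> (A *v x)"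
  by (simp add: spd_matrices_def)

lemma spd_nonneg: "A \<in> spd_matrices \<Longrightarrow> 0 \<le> x \<bullet> (A *v x)"
  by (cases "x = 0") (auto dest: spd_pos intro: less_imp_le)

lemma spd_eq_0_iff: "A \<in> spd_matrices \<Longrightarrow> x \<bullet> (A *v x) = 0 \<longleftrightarrow> x = 0"
  using spd_pos by fastforce

text \<open>Definiteness makes the kernel trivial, so the square matrix has a two-sided inverse; its
  existence is what gives the choice behind \<open>matrix_inv\<close> its meaning.\<close>

lemma spd_matrix_inv:
  assumes "A \<in> spd_matrices"
  shows "A *v (matrix_inv A *v x) = x"
proof -
  have "\<And>y. A *v y = 0 \<Longrightarrow> y = 0"
    using spd_eq_0_iff[OF assms] by fastforce
  then have "\<exists>B. A ** B = mat 1 \<and> B ** A = mat 1"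
    using matrix_left_invertible_ker invertible_left_inverse invertible_def by blast
  then have "A ** matrix_inv A = mat 1"
    unfolding matrix_inv_def by (rule someI2_ex) simp
  then show ?thesis
    by (simp add: matrix_vector_mul_assoc)
qed

text \<open>The form attains a positive minimum on the compact unit sphere, and homogeneity of
  degree two carries the bound to all vectors. It later turns a small value of the form into a small
  norm.\<close>

lemma spd_coercive:
  fixes A :: "real^'d::finite^'d"
  assumes "A \<in> spd_matrices"
  obtains \<mu> where "0 < \<mu>" "\<And>x. \<mu> * (norm x)\<^sup>2 \<le> x \<bullet> (A *v x)"
proof -
  let ?S = "sphere (0::real^'d) 1"
  have "continuous_on ?S (\<lambda>x. x \<bullet> (A *v x))"
    by (intro continuous_intros matrix_vector_mult_linear_continuous_on)
  then obtain z where z: "z \<in> ?S" "\<And>y. y \<in> ?S \<Longrightarrow> z \<bullet> (A *v z) \<le> y \<bullet> (A *v y)"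
    using continuous_attains_inf[of ?S "\<lambda>x. x \<bullet> (A *v x)"] by auto
  have "(z \<bullet> (A *v z)) * (norm x)\<^sup>2 \<le> x \<bullet> (A *v x)" for x
  proof (cases "x = 0")
    case False
    let ?y = "(1 / norm x) *\<^sub>R x"
    have "z \<bullet> (A *v z) \<le> ?y \<bullet> (A *v ?y)"
      using False by (intro z) simp
    also have "\<dots> = (x \<bullet> (A *v x)) / (norm x)\<^sup>2"
      by (simp add: matrix_vector_mult_scaleR power2_eq_square)
    finally show ?thesis using False by (simp add: pos_le_divide_eq)
  qed simp
  moreover have "0 < z \<bullet> (A *v z)"
    using z(1) by (intro spd_pos[OF assms]) auto
  ultimately show ?thesis using that by blast
qed

section \<open>Convex combinations of matrices\<close>

lemma matrix_vector_mult_sum_scaleR: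
  fixes A :: "'n::finite \<Rightarrow> real^'d::finite^'e::finite"
  shows "(\<Sum>i\<in>UNIV. u i *\<^sub>R A i) *v x = (\<Sum>i\<in>UNIV. u i *\<^sub>R (A i *v x))"
proof -
  have "linear (\<lambda>M::real^'d^'e. M *v x)"
    by (intro linearI) (simp_all add: matrix_vector_mult_add_rdistrib scaleR_matrix_vector_assoc)
  from linear_sum[OF this, of "\<lambda>i. u i *\<^sub>R A i"] show ?thesis
    by (simp add: scaleR_matrix_vector_assoc)
qed

lemma A_comb_mult: "A_comb A l *v x = (\<Sum>i\<in>UNIV. (l $ i) *\<^sub>R (A i *v x))"
  by (simp add: A_comb_def matrix_vector_mult_sum_scaleR)

lemma simplex_ex_pos: "l \<in> prob_simplex \<Longrightarrow> \<exists>i. 0 < l $ i"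
  using sum_nonpos[of UNIV "\<lambda>i. l $ i"] by (fastforce simp: prob_simplex_def not_less)

lemma A_comb_spd:
  assumes A: "\<forall>i. A i \<in> spd_matrices" and l: "l \<in> prob_simplex"
  shows "A_comb A l \<in> spd_matrices"
proof -
  have "transpose (A_comb A l) = A_comb A l"
    using A by (simp add: spd_matrices_def A_comb_def transpose_def vec_eq_iff)
  moreover have "0 < x \<bullet> (A_comb A l *v x)" if "x \<noteq> 0" for x
  proof -
    obtain i where "0 < l $ i" using simplex_ex_pos[OF l] by blast
    then have "0 < (\<Sum>i\<in>UNIV. l $ i * (x \<bullet> (A i *v x)))"
      using spd_pos[OF A[rule_format] that] l
      by (intro sum_pos2[of _ i]) (auto simp: prob_simplex_def spd_nonneg[OF A[rule_format]])
    then show ?thesis by (simp add: A_comb_mult inner_sum_right)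
  qed
  ultimately show ?thesis by (simp add: spd_matrices_def)
qed

section \<open>Squared distances and completing the square\<close>

definition sq_dist :: "('n \<Rightarrow> real^'d) \<Rightarrow> ('n \<Rightarrow> real^'d^'d) \<Rightarrow> 'n \<Rightarrow> real^'d \<Rightarrow> real" where
  "sq_dist c A i x = (x - c i) \<bullet> (A i *v (x - c i))"

lemma f_quad_eq:
  assumes "A i \<in> spd_matrices"
  shows "f_quad c A i x r = sq_dist c A i x - r\<^sup>2"
  using spd_inner_sym[OF assms, of "c i" x]
  by (simp add: f_quad_def sq_dist_def b_vec_def gamma_const_def matrix_vector_mult_diff_distrib
      inner_diff_left inner_diff_right inner_commute)

lemma sum_sq_dist_eq:
  assumes A: "\<forall>i. A i \<in> spd_matrices" and l: "l \<in> prob_simplex"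
  shows "(\<Sum>i\<in>UNIV. l $ i * sq_dist c A i x) =
    h_fun c A l + (x - m_center c A l) \<bullet> (A_comb A l *v (x - m_center c A l))"
proof -
  let ?M = "A_comb A l" and ?m = "m_center c A l" and ?b = "b_comb c A l"
  note M = A_comb_spd[OF A l]
  \<comment> \<open>This trades \<open>?b\<close> for \<open>?M *v ?m\<close>, so that both terms
    containing \<open>?b\<close> become forms in \<open>?M\<close>.\<close>
  have Mm: "?M *v ?m = - ?b"
    using spd_matrix_inv[OF M, of ?b]
    by (simp add: m_center_def vec.neg)
  have "sq_dist c A i x = x \<bullet> (A i *v x) + 2 * (b_vec c A i \<bullet> x) + c i \<bullet> (A i *v c i)" for i
    using f_quad_eq[where A=A and i=i and c=c and x=x and r=0] A
    by (simp add: f_quad_def gamma_const_def)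
  then have "(\<Sum>i\<in>UNIV. l $ i * sq_dist c A i x) =
      x \<bullet> (?M *v x) + 2 * (?b \<bullet> x) + (\<Sum>i\<in>UNIV. l $ i * (c i \<bullet> (A i *v c i)))"
    by (simp add: A_comb_mult b_comb_def inner_sum_right inner_sum_left distrib_left
        sum.distrib sum_distrib_left mult.left_commute)
  moreover have "?b \<bullet> (matrix_inv ?M *v ?b) = ?m \<bullet> (?M *v ?m)"
    unfolding Mm by (simp add: m_center_def inner_commute)
  moreover have "?b \<bullet> x = - (x \<bullet> (?M *v ?m))"
    unfolding Mm by (simp add: inner_commute)
  ultimately show ?thesis
    using spd_inner_sym[OF M, of ?m x]
    by (simp add: h_fun_def matrix_vector_mult_diff_distrib inner_diff_left inner_diff_right)
qed

text \<open>The weights have total one, so the \<open>r\<^sup>2\<close> in each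
  \<open>gamma_const\<close> contributes exactly one \<open>r\<^sup>2\<close>.\<close>

lemma g_fun_eq:
  assumes "l \<in> prob_simplex"
  shows "g_fun c A l r = h_fun c A l - r\<^sup>2"
  using assms
  by (simp add: g_fun_def h_fun_def gamma_comb_def gamma_const_def right_diff_distrib
      sum_subtractf prob_simplex_def flip: sum_distrib_right)

lemma E_comb_eq:
  assumes A: "\<forall>i. A i \<in> spd_matrices" and l: "l \<in> prob_simplex"
  shows "E_comb c A l r = {x. (\<Sum>i\<in>UNIV. l $ i * sq_dist c A i x) \<le> r\<^sup>2}"
  using l by (simp add: E_comb_def f_quad_eq[of A, OF A[rule_format]] right_diff_distrib
      sum_subtractf prob_simplex_def flip: sum_distrib_right)

section \<open>The function \<open>h_fun\<close> and its maximisers\<close>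

lemma continuous_on_sq_dist: "continuous_on S (sq_dist c A i)"
  unfolding sq_dist_def
  by (intro continuous_intros linear_continuous_on_compose[OF _ matrix_vector_mul_linear])

text \<open>At the centre the completed square vanishes, so \<open>h_fun\<close> is itself a
  weighted sum of squared distances.\<close>

lemma h_fun_nonneg:
  assumes A: "\<forall>i. A i \<in> spd_matrices" and l: "l \<in> prob_simplex"
  shows "0 \<le> h_fun c A l"
proof -
  have "0 \<le> (\<Sum>i\<in>UNIV. l $ i * sq_dist c A i (m_center c A l))"
    using l by (intro sum_nonneg)
      (simp add: prob_simplex_def sq_dist_def spd_nonneg[OF A[rule_format]])
  then show ?thesis by (simp add: sum_sq_dist_eq[OF A l])
qed

lemma sq_dist_le_h_fun:
  fixes c :: "'n::finite \<Rightarrow> real^'d::finite"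
  assumes A: "\<forall>i. A i \<in> spd_matrices" and l: "l \<in> prob_simplex"
    and max: "\<forall>l'\<in>prob_simplex. h_fun c A l' \<le> h_fun c A l"
  shows "sq_dist c A k (m_center c A l) \<le> h_fun c A l"
proof -
  let ?h = "h_fun c A l" and ?m = "m_center c A l"
  \<comment> \<open>The steps are 1/(n+2): the double successor keeps \<open>1 - t n\<close> at
    least 1/2, which is used for the convergence of the centres.\<close>
  define t where "t = (\<lambda>n. inverse (real (Suc (Suc n))))"
  define l' where "l' = (\<lambda>n. (1 - t n) *\<^sub>R l + t n *\<^sub>R axis k 1)"
  define m where "m = (\<lambda>n. m_center c A (l' n))"
  have t: "0 < t n" "t n \<le> 1/2" for n
    by (simp_all add: t_def field_simps)
  have l': "l' n \<in> prob_simplex" for n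
  proof -
    have "(\<Sum>i\<in>UNIV. axis k (1::real) $ i) = 1" by (simp add: axis_def)
    then show ?thesis
      using l t[of n]
      by (auto simp: l'_def prob_simplex_def sum.distrib axis_def simp flip: sum_distrib_left)
  qed
  \<comment> \<open>The weighted sum for \<open>l' n\<close> is evaluated at its own centre
    \<open>m n\<close>, where it equals \<open>h_fun c A (l' n)\<close>, hence is at most
    \<open>?h\<close>. Splitting it along \<open>l\<close> and the vertex and completing the square
    for \<open>l\<close> gives the claim.\<close>
  have step: "(1 - t n) * ((m n - ?m) \<bullet> (A_comb A l *v (m n - ?m)))
      + t n * sq_dist c A k (m n) \<le> t n * ?h" for n
  proof -
    have "(\<Sum>i\<in>UNIV. l' n $ i * sq_dist c A i (m n)) =
        (\<Sum>i\<in>UNIV. (1 - t n) * (l $ i * sq_dist c A i (m n))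
          + (if i = k then t n * sq_dist c A i (m n) else 0))"
      by (intro sum.cong) (auto simp: l'_def axis_def algebra_simps)
    also have "\<dots> = (1 - t n) * (\<Sum>i\<in>UNIV. l $ i * sq_dist c A i (m n))
        + t n * sq_dist c A k (m n)"
      by (simp add: sum.distrib sum_distrib_left)
    finally have "(1 - t n) * (\<Sum>i\<in>UNIV. l $ i * sq_dist c A i (m n))
        + t n * sq_dist c A k (m n) = h_fun c A (l' n)"
      using sum_sq_dist_eq[OF A l'[of n], of c "m n"] by (simp add: m_def)
    with bspec[OF max l'[of n]] show ?thesis
      unfolding sum_sq_dist_eq[OF A l] by (simp add: algebra_simps)
  qed
  \<comment> \<open>Drop the nonnegative square from \<open>step\<close> and cancel
    \<open>t n\<close>.\<close>
  have bound: "sq_dist c A k (m n) \<le> ?h" for n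
  proof -
    have "0 \<le> (1 - t n) * ((m n - ?m) \<bullet> (A_comb A l *v (m n - ?m)))"
      using t[of n] by (intro mult_nonneg_nonneg spd_nonneg[OF A_comb_spd[OF A l]]) auto
    with step[of n] have "t n * sq_dist c A k (m n) \<le> t n * ?h" by linarith
    with t[of n] show ?thesis by simp
  qed
  obtain \<mu> where \<mu>: "0 < \<mu>" "\<And>x. \<mu> * (norm x)\<^sup>2 \<le> x \<bullet> (A_comb A l *v x)"
    using spd_coercive[OF A_comb_spd[OF A l]] by blast
  \<comment> \<open>Now the distance term is dropped from \<open>step\<close> instead: the centres
    differ by a squared norm of order \<open>t n\<close>.\<close>
  have "(norm (m n - ?m))\<^sup>2 \<le> t n * (2 * ?h / \<mu>)" for n
  proof -
    have "0 \<le> t n * sq_dist c A k (m n)"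
      using t[of n] by (simp add: sq_dist_def spd_nonneg[OF A[rule_format]])
    moreover have "(1/2) * (\<mu> * (norm (m n - ?m))\<^sup>2)
        \<le> (1 - t n) * ((m n - ?m) \<bullet> (A_comb A l *v (m n - ?m)))"
      using t[of n] \<mu> by (intro mult_mono) auto
    ultimately have "(1/2) * (\<mu> * (norm (m n - ?m))\<^sup>2) \<le> t n * ?h"
      using step[of n] by linarith
    then show ?thesis using \<mu>(1) by (simp add: field_simps)
  qed
  moreover have "(\<lambda>n. t n * (2 * ?h / \<mu>)) \<longlonglongrightarrow> 0"
    unfolding t_def
    by (rule tendsto_mult_left_zero[OF LIMSEQ_Suc[OF LIMSEQ_inverse_real_of_nat]])
  ultimately have "(\<lambda>n. (norm (m n - ?m))\<^sup>2) \<longlonglongrightarrow> 0"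
    by - (rule Lim_null_comparison, simp_all)
  from tendsto_real_sqrt[OF this] have "(\<lambda>n. norm (m n - ?m)) \<longlonglongrightarrow> 0"
    by simp
  then have "m \<longlonglongrightarrow> ?m"
    by (simp add: tendsto_norm_zero_iff LIM_zero_iff)
  moreover have "isCont (sq_dist c A k) ?m"
    using continuous_on_sq_dist[of UNIV c A k] by (simp add: continuous_on_eq_continuous_at)
  ultimately have "(\<lambda>n. sq_dist c A k (m n)) \<longlonglongrightarrow> sq_dist c A k ?m"
    by (rule isCont_tendsto_compose[rotated])
  then show ?thesis
    by (rule LIMSEQ_le_const2) (use bound in blast)
qed

theorem theorem2p13:
  fixes c :: "'n::finite \<Rightarrow> real^'d::finite"
    and A :: "'n \<Rightarrow> real^'d^'d"
    and lstar :: "real^'n"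
  assumes spd: "\<And>i. A i \<in> spd_matrices"
    and argmin: "is_arg_min (F_fun c A) (\<lambda>l. l \<in> prob_simplex) lstar"
  shows "(\<forall>r\<ge>0. (\<Inter>i. ellipsoid r (c i) (A i)) \<noteq> {} \<longleftrightarrow> g_fun c A lstar r \<le> 0)
    \<and> (r_star c A \<in> feasible_radii c A \<and> (\<forall>r\<in>feasible_radii c A. r_star c A \<le> r)
       \<and> r_star c A = sqrt (MAX i. (norm_wrt (A i) (c i - m_center c A lstar))\<^sup>2)
       \<and> r_star c A = sqrt (- F_fun c A lstar)
       \<and> r_star c A = sqrt (h_fun c A lstar)
       \<and> g_fun c A lstar (r_star c A) = 0
       \<and> E_comb c A lstar (r_star c A) = {m_center c A lstar})
    \<and> ((r_star c A = 0 \<longleftrightarrow> (\<forall>i j. c i = c j))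
       \<and> (CARD('n) = 1 \<longrightarrow> (\<forall>i. m_center c A lstar = c i) \<and> r_star c A = 0))"
proof -
  let ?m = "m_center c A lstar" and ?h = "h_fun c A lstar"
  have l: "lstar \<in> prob_simplex"
    and max: "\<forall>l\<in>prob_simplex. h_fun c A l \<le> ?h"
    using argmin by (auto simp: is_arg_min_linorder F_fun_def)
  have A: "\<forall>i. A i \<in> spd_matrices" using spd by blast
  have nonneg: "\<And>i. 0 \<le> lstar $ i" and sum1: "(\<Sum>i\<in>UNIV. lstar $ i) = 1"
    using l by (auto simp: prob_simplex_def)
  note M = A_comb_spd[OF A l]
  note decomp = sum_sq_dist_eq[OF A l, of c]
  note upper = sq_dist_le_h_fun[OF A l max]
  have h0: "0 \<le> ?h" by (rule h_fun_nonneg[OF A l])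
  \<comment> \<open>A weighted mean of the squared distances is at most \<open>B\<close>, and it
    exceeds \<open>?h\<close> by a nonnegative square.\<close>
  have lower: "?h \<le> B" if "\<And>i. sq_dist c A i x \<le> B" for x B
  proof -
    have "?h \<le> (\<Sum>i\<in>UNIV. lstar $ i * sq_dist c A i x)"
      by (simp add: decomp spd_nonneg[OF M])
    also have "\<dots> \<le> (\<Sum>i\<in>UNIV. lstar $ i * B)"
      by (intro sum_mono mult_left_mono that nonneg)
    finally show ?thesis by (simp add: sum1 flip: sum_distrib_right)
  qed
  have "(\<Inter>i. ellipsoid r (c i) (A i)) = {x. \<forall>i. sq_dist c A i x \<le> r\<^sup>2}" for r
    by (auto simp: ellipsoid_def sq_dist_def)
  then have "(\<Inter>i. ellipsoid r (c i) (A i)) \<noteq> {} \<longleftrightarrow> (\<exists>x. \<forall>i. sq_dist c A i x \<le> r\<^sup>2)" for r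
    by simp
  \<comment> \<open>For the converse direction the point \<open>?m\<close> is a witness, whatever
    \<open>B\<close> is.\<close>
  moreover have "(\<exists>x. \<forall>i. sq_dist c A i x \<le> B) \<longleftrightarrow> ?h \<le> B" for B
    by (meson lower upper order_trans)
  ultimately have inter: "(\<Inter>i. ellipsoid r (c i) (A i)) \<noteq> {} \<longleftrightarrow> ?h \<le> r\<^sup>2" for r
    by simp
  \<comment> \<open>A closed ray has a minimum, so the \<open>LEAST\<close> in \<open>r_star\<close>
    is attained.\<close>
  have feas: "feasible_radii c A = {sqrt ?h..}"
    unfolding feasible_radii_def inter
    by (auto intro: real_le_lsqrt sqrt_le_D order_trans[OF real_sqrt_ge_zero[OF h0]])
  have rstar_eq: "r_star c A = sqrt ?h"
    unfolding r_star_def feas by (rule Least_equality) auto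
  \<comment> \<open>The two sides subtract in opposite order; the form is even.\<close>
  have nrm: "(norm_wrt (A i) (c i - ?m))\<^sup>2 = sq_dist c A i ?m" for i
  proof -
    have "(norm_wrt (A i) (c i - ?m))\<^sup>2 = (c i - ?m) \<bullet> (A i *v (c i - ?m))"
      by (simp add: norm_wrt_def spd_nonneg[OF spd])
    then show ?thesis
      by (simp add: sq_dist_def matrix_vector_mult_diff_distrib inner_diff_left inner_diff_right)
  qed
  have "(MAX i. sq_dist c A i ?m) = ?h"
    by (intro antisym lower[of ?m]) (auto intro: upper)
  then have MAX: "(MAX i. (norm_wrt (A i) (c i - ?m))\<^sup>2) = ?h"
    by (simp add: nrm)
  \<comment> \<open>At radius \<open>sqrt ?h\<close> the constant \<open>?h\<close> cancels, leaving
    only the condition that the completed square is at most 0.\<close>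
  have "x \<bullet> (A_comb A lstar *v x) \<le> 0 \<longleftrightarrow> x = 0" for x
    using spd_nonneg[OF M, of x] spd_eq_0_iff[OF M, of x] by linarith
  then have E: "E_comb c A lstar (sqrt ?h) = {?m}"
    using h0 by (simp add: E_comb_eq[OF A l] decomp)
  \<comment> \<open>The squared distance lies between 0 and \<open>?h\<close>, so definiteness
    forces \<open>?m\<close> onto every centre.\<close>
  have center: "?m = c i" if "?h = 0" for i
  proof -
    have "sq_dist c A i ?m = 0"
      using upper[of i] that spd_nonneg[OF spd] by (intro antisym) (auto simp: sq_dist_def)
    then show ?thesis by (simp add: sq_dist_def spd_eq_0_iff[OF spd])
  qed
  have zero: "?h = 0 \<longleftrightarrow> (\<forall>i j. c i = c j)"
  proof
    assume "\<forall>i j. c i = c j"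
    \<comment> \<open>Here \<open>undefined\<close> is just some index: all distances vanish at the
      common centre, and \<open>lower\<close> applies with \<open>B = 0\<close>.\<close>
    then have "\<And>i. sq_dist c A i (c undefined) \<le> 0"
      by (metis diff_self inner_zero_left order_refl sq_dist_def)
    then show "?h = 0" using lower h0 by (meson antisym)
  qed (metis center)
  have single: "?h = 0" if "CARD('n) = 1"
    unfolding zero using that by (metis UNIV_I card_1_singletonE singletonD)
  show ?thesis
  proof (intro conjI allI impI ballI)
    show "r_star c A = 0 \<longleftrightarrow> (\<forall>i j. c i = c j)"
      by (simp only: rstar_eq real_sqrt_eq_0_iff zero)
    show "?m = c i" if "CARD('n) = 1" for i
      using center single[OF that] by blast
    show "r_star c A = 0" if "CARD('n) = 1"
      by (simp add: rstar_eq single[OF that])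
    show "(\<Inter>i. ellipsoid r (c i) (A i)) \<noteq> {} \<longleftrightarrow> g_fun c A lstar r \<le> 0" for r
      unfolding inter g_fun_eq[OF l] by simp
    show "r_star c A \<in> feasible_radii c A"
      by (simp add: rstar_eq feas)
    show "r_star c A \<le> r" if "r \<in> feasible_radii c A" for r
      using that by (simp add: rstar_eq feas)
    show "r_star c A = sqrt (MAX i. (norm_wrt (A i) (c i - ?m))\<^sup>2)"
      unfolding MAX by (rule rstar_eq)
    show "r_star c A = sqrt (- F_fun c A lstar)"
      by (simp add: rstar_eq F_fun_def)
    show "r_star c A = sqrt ?h"
      by (rule rstar_eq)
    show "g_fun c A lstar (r_star c A) = 0"
      by (simp add: rstar_eq g_fun_eq[OF l] h0)
    show "E_comb c A lstar (r_star c A) = {?m}"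
      unfolding rstar_eq by (rule E)
  qed
qed

end
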